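(* Every Markov category that has conditionals and ranges is productive.
   Context: Composition in diagrammatic order $;$, coherence isomorphisms suppressed. A Markov category is a symmetric monoidal category in which every object $X$ has a cocommutative comonoid structure $(\delta_X\colon X\to X\otimes X,\ \varepsilon_X\colon X\to I)$ such that $\delta_{X\otimes Y}=(\delta_X\otimes\delta_Y);(\mathrm{id}\otimes\sigma_{X,Y}\otimes\mathrm{id})$, $\varepsilon_{X\otimes Y}=\varepsilon_X\otimes\varepsilon_Y$, and $f;\varepsilon_Y=\varepsilon_X$ for all $f\colon X\to Y$ (comultiplication need not be natural). For $f\colon A\to B$ and $g\colon A\otimes B\otimes X\to Y$ (inputs reordered by symmetries as needed), $f\triangleleft g\colon A\otimes X\to B\otimes Y$ is $(\delta_A\otimes\mathrm{id});(f;\delta_B)\otimes\mathrm{id}$ followed by $g$ on the copies of $A,B$ and on $X$ (the output $B$ being kept). Conditionals: for every $f\colon A\to X\otimes Y$, with $f_X:=f;(\mathrm{id}_X\otimes\varepsilon_Y)$, there is $c_f\colon X\otimes A\to Y$ with $f=f_X\triangleleft c_f$. Ranges: for every $f\colon A\to B$ there is $r_f\colon A\otimes B\to A\otimes B$ with $f\triangleleft\mathrm{id}=f\triangleleft r_f$, $r_f;\delta=\delta;(r_f\otimes r_f)$, and such that $f\triangleleft g=f\triangleleft h$ implies $(r_f\otimes\mathrm{id});g=(r_f\otimes\mathrm{id});h$ for all suitably typed $g,h$. Productive: for objects $P,Q$ write $\langle h\rangle$ for the class of $h\colon P\to W\otimes Q$ in $\int^W\mathcal{C}(P,W\otimes Q)$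 (morphisms with varying $W$ modulo the equivalence generated by $h;(r\otimes1_Q)\sim h$). $\mathcal{C}$ is productive if for all $X_0,Y_0$ every class $\alpha\in\int^M\mathcal{C}(X_0,M\otimes Y_0)$ admits $M_0$, $\alpha_0\colon X_0\to M_0\otimes Y_0$, and for each representative $\alpha_i\colon X_0\to M_i\otimes Y_0$ a morphism $s_i\colon M_0\to M_i$ with $\alpha_i=\alpha_0;(s_i\otimes1)$, such that for all $u\colon M_i\otimes A\to U\otimes B$, $v\colon M_j\otimes A\to V\otimes B$, $\langle(\alpha_i\otimes1_A);(u\otimes1_{Y_0})\rangle=\langle(\alpha_j\otimes1_A);(v\otimes1_{Y_0})\rangle$ implies $\langle(s_i\otimes1_A);u\rangle=\langle(s_j\otimes1_A);v\rangle$. *)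

theory Defs
  imports Main
begin

text \<open>
  Categories are given by an object set, an arrow set and source/target maps; the operations are
  only constrained on these carriers. Composition is in diagrammatic order.
\<close>

record ('o, 'a) category =
  Obj :: "'o set"
  Arr :: "'a set"
  src :: "'a \<Rightarrow> 'o"
  tgt :: "'a \<Rightarrow> 'o"
  ide :: "'o \<Rightarrow> 'a" (\<open>\<one>\<index>\<close>)
  cmp :: "'a \<Rightarrow> 'a \<Rightarrow> 'a" (infixl \<open>\<Zsemi>\<index>\<close> 60)

definition hom :: "('o, 'a, 'm) category_scheme \<Rightarrow> 'o \<Rightarrow> 'o \<Rightarrow> 'a set" where
  "hom C X Y = {f \<in> Arr C. src C f = X \<and> tgt C f = Y}"

locale category =
  fixes C :: "('o, 'a, 'm) category_scheme" (structure)
  assumes src_Obj: "f \<in> Arr C \<Longrightarrow> src C f \<in> Obj C"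
    and tgt_Obj: "f \<in> Arr C \<Longrightarrow> tgt C f \<in> Obj C"
    and ide_hom: "X \<in> Obj C \<Longrightarrow> \<one> X \<in> hom C X X"
    and cmp_hom: "f \<in> hom C X Y \<Longrightarrow> g \<in> hom C Y Z \<Longrightarrow> f \<Zsemi> g \<in> hom C X Z"
    and ide_left: "f \<in> hom C X Y \<Longrightarrow> \<one> X \<Zsemi> f = f"
    and ide_right: "f \<in> hom C X Y \<Longrightarrow> f \<Zsemi> \<one> Y = f"
    and cmp_assoc: "f \<in> hom C W X \<Longrightarrow> g \<in> hom C X Y \<Longrightarrow> h \<in> hom C Y Z \<Longrightarrow>
      (f \<Zsemi> g) \<Zsemi> h = f \<Zsemi> (g \<Zsemi> h)"

context
  fixes C :: "('o, 'a, 'm) category_scheme" (structure)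
begin

definition inverse_arrows :: "'a \<Rightarrow> 'a \<Rightarrow> bool" where
  "inverse_arrows f g \<longleftrightarrow> f \<in> Arr C \<and> g \<in> hom C (tgt C f) (src C f) \<and>
     f \<Zsemi> g = \<one> (src C f) \<and> g \<Zsemi> f = \<one> (tgt C f)"

definition iso :: "'a \<Rightarrow> bool" where
  "iso f \<longleftrightarrow> (\<exists>g. inverse_arrows f g)"

definition inv_arr :: "'a \<Rightarrow> 'a" where
  "inv_arr f = (THE g. inverse_arrows f g)"

end

record ('o, 'a) sm_category = "('o, 'a) category" +
  tens :: "'o \<Rightarrow> 'o \<Rightarrow> 'o" (infixr \<open>\<otimes>\<index>\<close> 70)
  tensA :: "'a \<Rightarrow> 'a \<Rightarrow> 'a" (infixr \<open>\<otimes>\<^sub>a\<index>\<close> 70)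
  unit :: "'o" (\<open>\<I>\<index>\<close>)
  asso :: "'o \<Rightarrow> 'o \<Rightarrow> 'o \<Rightarrow> 'a"
  lunit :: "'o \<Rightarrow> 'a"
  runit :: "'o \<Rightarrow> 'a"
  sym :: "'o \<Rightarrow> 'o \<Rightarrow> 'a"

locale monoidal_category = category C
  for C :: "('o, 'a, 'm) sm_category_scheme" (structure) +
  assumes tens_Obj: "X \<in> Obj C \<Longrightarrow> Y \<in> Obj C \<Longrightarrow> X \<otimes> Y \<in> Obj C"
    and unit_Obj: "\<I> \<in> Obj C"
    and tensA_hom: "f \<in> hom C X Y \<Longrightarrow> g \<in> hom C Z W \<Longrightarrow> f \<otimes>\<^sub>a g \<in> hom C (X \<otimes> Z) (Y \<otimes> W)"
    and tensA_ide: "X \<in> Obj C \<Longrightarrow> Y \<in> Obj C \<Longrightarrow> \<one> X \<otimes>\<^sub>a \<one> Y = \<one> (X \<otimes> Y)"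
    and tensA_cmp: "f \<in> hom C X Y \<Longrightarrow> f' \<in> hom C Y Z \<Longrightarrow> g \<in> hom C X' Y' \<Longrightarrow> g' \<in> hom C Y' Z' \<Longrightarrow>
      (f \<Zsemi> f') \<otimes>\<^sub>a (g \<Zsemi> g') = (f \<otimes>\<^sub>a g) \<Zsemi> (f' \<otimes>\<^sub>a g')"
    and asso_hom: "X \<in> Obj C \<Longrightarrow> Y \<in> Obj C \<Longrightarrow> Z \<in> Obj C \<Longrightarrow>
      asso C X Y Z \<in> hom C ((X \<otimes> Y) \<otimes> Z) (X \<otimes> (Y \<otimes> Z))"
    and asso_iso: "X \<in> Obj C \<Longrightarrow> Y \<in> Obj C \<Longrightarrow> Z \<in> Obj C \<Longrightarrow> iso C (asso C X Y Z)"
    and asso_natural: "f \<in> hom C X X' \<Longrightarrow> g \<in> hom C Y Y' \<Longrightarrow> h \<in> hom C Z Z' \<Longrightarrow>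
      ((f \<otimes>\<^sub>a g) \<otimes>\<^sub>a h) \<Zsemi> asso C X' Y' Z' = asso C X Y Z \<Zsemi> (f \<otimes>\<^sub>a (g \<otimes>\<^sub>a h))"
    and lunit_hom: "X \<in> Obj C \<Longrightarrow> lunit C X \<in> hom C (\<I> \<otimes> X) X"
    and lunit_iso: "X \<in> Obj C \<Longrightarrow> iso C (lunit C X)"
    and lunit_natural: "f \<in> hom C X Y \<Longrightarrow> (\<one> \<I> \<otimes>\<^sub>a f) \<Zsemi> lunit C Y = lunit C X \<Zsemi> f"
    and runit_hom: "X \<in> Obj C \<Longrightarrow> runit C X \<in> hom C (X \<otimes> \<I>) X"
    and runit_iso: "X \<in> Obj C \<Longrightarrow> iso C (runit C X)"
    and runit_natural: "f \<in> hom C X Y \<Longrightarrow> (f \<otimes>\<^sub>a \<one> \<I>) \<Zsemi> runit C Y = runit C X \<Zsemi> f"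
    and pentagon: "W \<in> Obj C \<Longrightarrow> X \<in> Obj C \<Longrightarrow> Y \<in> Obj C \<Longrightarrow> Z \<in> Obj C \<Longrightarrow>
      asso C (W \<otimes> X) Y Z \<Zsemi> asso C W X (Y \<otimes> Z) =
      (asso C W X Y \<otimes>\<^sub>a \<one> Z) \<Zsemi> asso C W (X \<otimes> Y) Z \<Zsemi> (\<one> W \<otimes>\<^sub>a asso C X Y Z)"
    and triangle: "X \<in> Obj C \<Longrightarrow> Y \<in> Obj C \<Longrightarrow>
      asso C X \<I> Y \<Zsemi> (\<one> X \<otimes>\<^sub>a lunit C Y) = runit C X \<otimes>\<^sub>a \<one> Y"

locale symmetric_monoidal_category = monoidal_category C
  for C :: "('o, 'a, 'm) sm_category_scheme" (structure) +
  assumes sym_hom: "X \<in> Obj C \<Longrightarrow> Y \<in> Obj C \<Longrightarrow> sym C X Y \<in> hom C (X \<otimes> Y) (Y \<otimes> X)"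
    and sym_natural: "f \<in> hom C X X' \<Longrightarrow> g \<in> hom C Y Y' \<Longrightarrow>
      (f \<otimes>\<^sub>a g) \<Zsemi> sym C X' Y' = sym C X Y \<Zsemi> (g \<otimes>\<^sub>a f)"
    and sym_sym: "X \<in> Obj C \<Longrightarrow> Y \<in> Obj C \<Longrightarrow> sym C X Y \<Zsemi> sym C Y X = \<one> (X \<otimes> Y)"
    and hexagon: "X \<in> Obj C \<Longrightarrow> Y \<in> Obj C \<Longrightarrow> Z \<in> Obj C \<Longrightarrow>
      asso C X Y Z \<Zsemi> sym C X (Y \<otimes> Z) \<Zsemi> asso C Y Z X =
      (sym C X Y \<otimes>\<^sub>a \<one> Z) \<Zsemi> asso C Y X Z \<Zsemi> (\<one> Y \<otimes>\<^sub>a sym C X Z)"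

context
  fixes C :: "('o, 'a, 'm) sm_category_scheme" (structure)
begin

text \<open>\<open>(A \<otimes> B) \<otimes> (D \<otimes> E) \<longrightarrow> (A \<otimes> D) \<otimes> (B \<otimes> E)\<close>\<close>

definition mid_swap :: "'o \<Rightarrow> 'o \<Rightarrow> 'o \<Rightarrow> 'o \<Rightarrow> 'a" where
  "mid_swap A B D E =
     asso C A B (D \<otimes> E) \<Zsemi>
     (\<one> A \<otimes>\<^sub>a (inv_arr C (asso C B D E) \<Zsemi> (sym C B D \<otimes>\<^sub>a \<one> E) \<Zsemi> asso C D B E)) \<Zsemi>
     inv_arr C (asso C A D (B \<otimes> E))"

text \<open>\<open>(A \<otimes> B) \<otimes> D \<longrightarrow> (A \<otimes> D) \<otimes> B\<close>\<close>

definition right_swap :: "'o \<Rightarrow> 'o \<Rightarrow> 'o \<Rightarrow> 'a" where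
  "right_swap A B D =
     asso C A B D \<Zsemi> (\<one> A \<otimes>\<^sub>a sym C B D) \<Zsemi> inv_arr C (asso C A D B)"

end

record ('o, 'a) markov_category = "('o, 'a) sm_category" +
  copy :: "'o \<Rightarrow> 'a" (\<open>\<delta>\<index>\<close>)
  del :: "'o \<Rightarrow> 'a" (\<open>\<epsilon>\<index>\<close>)

locale markov_category = symmetric_monoidal_category C
  for C :: "('o, 'a, 'm) markov_category_scheme" (structure) +
  assumes copy_hom: "X \<in> Obj C \<Longrightarrow> \<delta> X \<in> hom C X (X \<otimes> X)"
    and del_hom: "X \<in> Obj C \<Longrightarrow> \<epsilon> X \<in> hom C X \<I>"
    and copy_coassoc: "X \<in> Obj C \<Longrightarrow>
      \<delta> X \<Zsemi> (\<delta> X \<otimes>\<^sub>a \<one> X) \<Zsemi> asso C X X X = \<delta> X \<Zsemi> (\<one> X \<otimes>\<^sub>a \<delta> X)"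
    and copy_counit_left: "X \<in> Obj C \<Longrightarrow> \<delta> X \<Zsemi> (\<epsilon> X \<otimes>\<^sub>a \<one> X) \<Zsemi> lunit C X = \<one> X"
    and copy_counit_right: "X \<in> Obj C \<Longrightarrow> \<delta> X \<Zsemi> (\<one> X \<otimes>\<^sub>a \<epsilon> X) \<Zsemi> runit C X = \<one> X"
    and copy_cocomm: "X \<in> Obj C \<Longrightarrow> \<delta> X \<Zsemi> sym C X X = \<delta> X"
    and copy_tens: "X \<in> Obj C \<Longrightarrow> Y \<in> Obj C \<Longrightarrow>
      \<delta> (X \<otimes> Y) = (\<delta> X \<otimes>\<^sub>a \<delta> Y) \<Zsemi> mid_swap C X X Y Y"
    and del_tens: "X \<in> Obj C \<Longrightarrow> Y \<in> Obj C \<Longrightarrow>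
      \<epsilon> (X \<otimes> Y) = (\<epsilon> X \<otimes>\<^sub>a \<epsilon> Y) \<Zsemi> lunit C \<I>"
    and del_natural: "f \<in> hom C X Y \<Longrightarrow> f \<Zsemi> \<epsilon> Y = \<epsilon> X"

context
  fixes C :: "('o, 'a, 'm) markov_category_scheme" (structure)
begin

text \<open>
  For \<open>f : A \<longrightarrow> B\<close> and \<open>g : (A \<otimes> B) \<otimes> X \<longrightarrow> Y\<close>, \<open>tri f X g\<close> is
  \<open>f \<triangleleft> g : A \<otimes> X \<longrightarrow> B \<otimes> Y\<close>; the object \<open>X\<close> is an explicit argument because
  it is not determined by the source of \<open>g\<close>. The wires run through
  \<open>(A \<otimes> (B \<otimes> B)) \<otimes> X\<close>, \<open>((A \<otimes> B) \<otimes> B) \<otimes> X\<close>, \<open>(B \<otimes> (A \<otimes> B)) \<otimes> X\<close> and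
  \<open>B \<otimes> ((A \<otimes> B) \<otimes> X)\<close>.
\<close>

definition tri :: "'a \<Rightarrow> 'o \<Rightarrow> 'a \<Rightarrow> 'a" where
  "tri f X g =
     (let A = src C f; B = tgt C f in
       (\<delta> A \<otimes>\<^sub>a \<one> X) \<Zsemi>
       ((\<one> A \<otimes>\<^sub>a (f \<Zsemi> \<delta> B)) \<otimes>\<^sub>a \<one> X) \<Zsemi>
       (inv_arr C (asso C A B B) \<otimes>\<^sub>a \<one> X) \<Zsemi>
       (sym C (A \<otimes> B) B \<otimes>\<^sub>a \<one> X) \<Zsemi>
       asso C B (A \<otimes> B) X \<Zsemi>
       (\<one> B \<otimes>\<^sub>a g))"

text \<open>
  The case of no extra wire: \<open>X\<close> is the unit, and \<open>f \<triangleleft> g : A \<longrightarrow> B \<otimes> Y\<close> for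
  \<open>g : A \<otimes> B \<longrightarrow> Y\<close>.
\<close>

definition tri_unit :: "'a \<Rightarrow> 'a \<Rightarrow> 'a" where
  "tri_unit f g =
     inv_arr C (runit C (src C f)) \<Zsemi> tri f \<I> (runit C (src C f \<otimes> tgt C f) \<Zsemi> g)"

definition has_conditionals :: bool where
  "has_conditionals \<longleftrightarrow>
     (\<forall>A \<in> Obj C. \<forall>X \<in> Obj C. \<forall>Y \<in> Obj C. \<forall>f \<in> hom C A (X \<otimes> Y).
        \<exists>c \<in> hom C (X \<otimes> A) Y.
          f = tri_unit (f \<Zsemi> (\<one> X \<otimes>\<^sub>a \<epsilon> Y) \<Zsemi> runit C X) (sym C A X \<Zsemi> c))"

definition is_range :: "'a \<Rightarrow> 'a \<Rightarrow> bool" where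
  "is_range f r \<longleftrightarrow>
     (let A = src C f; B = tgt C f in
       r \<in> hom C (A \<otimes> B) (A \<otimes> B) \<and>
       tri_unit f (\<one> (A \<otimes> B)) = tri_unit f r \<and>
       r \<Zsemi> \<delta> (A \<otimes> B) = \<delta> (A \<otimes> B) \<Zsemi> (r \<otimes>\<^sub>a r) \<and>
       (\<forall>X \<in> Obj C. \<forall>Y \<in> Obj C.
         \<forall>g \<in> hom C ((A \<otimes> B) \<otimes> X) Y. \<forall>h \<in> hom C ((A \<otimes> B) \<otimes> X) Y.
           tri f X g = tri f X h \<longrightarrow> (r \<otimes>\<^sub>a \<one> X) \<Zsemi> g = (r \<otimes>\<^sub>a \<one> X) \<Zsemi> h))"

definition has_ranges :: bool where
  "has_ranges \<longleftrightarrow> (\<forall>f \<in> Arr C. \<exists>r. is_range f r)"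

end

context
  fixes C :: "('o, 'a, 'm) sm_category_scheme" (structure)
begin

text \<open>
  The coend of \<open>hom P (W \<otimes> Q)\<close> over \<open>W\<close>. Representatives are pairs \<open>(W, h)\<close>, since \<open>W\<close> cannot
  be recovered from the target of \<open>h\<close>.
\<close>

definition coend_rep :: "'o \<Rightarrow> 'o \<Rightarrow> ('o \<times> 'a) set" where
  "coend_rep P Q = {(W, h). W \<in> Obj C \<and> h \<in> hom C P (W \<otimes> Q)}"

definition coend_step :: "'o \<Rightarrow> 'o \<Rightarrow> (('o \<times> 'a) \<times> ('o \<times> 'a)) set" where
  "coend_step P Q = {((W', h \<Zsemi> (r \<otimes>\<^sub>a \<one> Q)), (W, h)) | W W' h r.
     W \<in> Obj C \<and> W' \<in> Obj C \<and> h \<in> hom C P (W \<otimes> Q) \<and> r \<in> hom C W W'}"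

definition coend_rel :: "'o \<Rightarrow> 'o \<Rightarrow> (('o \<times> 'a) \<times> ('o \<times> 'a)) set" where
  "coend_rel P Q = (coend_step P Q \<union> (coend_step P Q)\<inverse>)\<^sup>* \<inter> (coend_rep P Q \<times> coend_rep P Q)"

definition coend :: "'o \<Rightarrow> 'o \<Rightarrow> ('o \<times> 'a) set set" where
  "coend P Q = coend_rep P Q // coend_rel P Q"

definition coend_class :: "'o \<Rightarrow> 'o \<Rightarrow> 'o \<Rightarrow> 'a \<Rightarrow> ('o \<times> 'a) set" where
  "coend_class P Q W h = coend_rel P Q `` {(W, h)}"

text \<open>
  For \<open>a : X \<longrightarrow> M \<otimes> Y\<close> and \<open>u : M \<otimes> A \<longrightarrow> U \<otimes> B\<close>, the composite
  \<open>(a \<otimes> 1) ; (u \<otimes> 1) : X \<otimes> A \<longrightarrow> U \<otimes> (B \<otimes> Y)\<close> with the reorderings made explicit.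
\<close>

definition plug :: "'o \<Rightarrow> 'o \<Rightarrow> 'o \<Rightarrow> 'o \<Rightarrow> 'o \<Rightarrow> 'a \<Rightarrow> 'a \<Rightarrow> 'a" where
  "plug M Y A U B a u =
     (a \<otimes>\<^sub>a \<one> A) \<Zsemi> right_swap C M Y A \<Zsemi> (u \<otimes>\<^sub>a \<one> Y) \<Zsemi> asso C U B Y"

definition productive :: bool where
  "productive \<longleftrightarrow>
     (\<forall>X0 \<in> Obj C. \<forall>Y0 \<in> Obj C. \<forall>\<alpha> \<in> coend X0 Y0.
       \<exists>M0 \<in> Obj C. \<exists>a0 \<in> hom C X0 (M0 \<otimes> Y0). \<exists>s :: 'o \<Rightarrow> 'a \<Rightarrow> 'a.
         (\<forall>(M, a) \<in> \<alpha>. s M a \<in> hom C M0 M \<and> a = a0 \<Zsemi> (s M a \<otimes>\<^sub>a \<one> Y0)) \<and>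
         (\<forall>(Mi, ai) \<in> \<alpha>. \<forall>(Mj, aj) \<in> \<alpha>.
           \<forall>A \<in> Obj C. \<forall>B \<in> Obj C. \<forall>U \<in> Obj C. \<forall>V \<in> Obj C.
           \<forall>u \<in> hom C (Mi \<otimes> A) (U \<otimes> B). \<forall>v \<in> hom C (Mj \<otimes> A) (V \<otimes> B).
             coend_class (X0 \<otimes> A) (B \<otimes> Y0) U (plug Mi Y0 A U B ai u) =
             coend_class (X0 \<otimes> A) (B \<otimes> Y0) V (plug Mj Y0 A V B aj v) \<longrightarrow>
             coend_class (M0 \<otimes> A) B U ((s Mi ai \<otimes>\<^sub>a \<one> A) \<Zsemi> u) =
             coend_class (M0 \<otimes> A) B V ((s Mj aj \<otimes>\<^sub>a \<one> A) \<Zsemi> v)))"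

end

end

theory Submission
  imports Defs
begin

text \<open>
  Conditionals show that \<open>h : P \<longrightarrow> W \<otimes> Q\<close> is the image, under a morphism acting on \<open>W\<close> only, of
  a morphism \<open>P \<longrightarrow> (P \<otimes> Q) \<otimes> Q\<close> which depends only on the marginal \<open>f : P \<longrightarrow> Q\<close> of \<open>h\<close>,
  namely \<open>f\<close> with its input and output copied. Hence a class of the coend is the same thing as a
  marginal. Take for \<open>\<alpha>\<^sub>0\<close> the copied marginal of \<open>\<alpha>\<close> and \<open>s\<^sub>i = r ; c\<^sub>i\<close>, where \<open>c\<^sub>i\<close> is a conditional
  of \<open>\<alpha>\<^sub>i\<close> and \<open>r\<close> is a range of the marginal. An equality of classes after composition with \<open>\<alpha>\<^sub>i\<close> and
  \<open>\<alpha>\<^sub>j\<close> is then an equation \<open>f \<triangleleft> g = f \<triangleleft> h\<close> between marginals, which the range converts into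
  \<open>(r \<otimes> 1) ; g = (r \<otimes> 1) ; h\<close>, again an equality of marginals.
\<close>

section \<open>Typing and invertible arrows\<close>

lemma in_hom_iff: "f \<in> hom C X Y \<longleftrightarrow> f \<in> Arr C \<and> src C f = X \<and> tgt C f = Y"
  by (simp add: hom_def)

context category
begin

text \<open>The axioms name the endpoints of hom-sets explicitly. Here and below they are restated
  through \<open>src\<close> and \<open>tgt\<close>, so that composability is settled by computing
  endpoints.\<close>

lemma ide_typ [simp]:
  assumes "X \<in> Obj C"
  shows "\<one> X \<in> Arr C" "src C (\<one> X) = X" "tgt C (\<one> X) = X"
  using ide_hom[OF assms] by (simp_all add: in_hom_iff)

lemma cmp_typ [simp]:
  assumes "f \<in> Arr C" "g \<in> Arr C" "tgt C f = src C g"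
  shows "f \<Zsemi> g \<in> Arr C" "src C (f \<Zsemi> g) = src C f" "tgt C (f \<Zsemi> g) = tgt C g"
  using cmp_hom[of f "src C f" "src C g" g "tgt C g"] assms by (simp_all add: in_hom_iff)

lemma cmp_assoc_arr:
  assumes "f \<in> Arr C" "g \<in> Arr C" "h \<in> Arr C" "tgt C f = src C g" "tgt C g = src C h"
  shows "(f \<Zsemi> g) \<Zsemi> h = f \<Zsemi> (g \<Zsemi> h)"
  using cmp_assoc[of f "src C f" "src C g" g "src C h" h "tgt C h"] assms
  by (simp add: in_hom_iff)

lemma ide_left_arr [simp]: "f \<in> Arr C \<Longrightarrow> src C f = X \<Longrightarrow> \<one> X \<Zsemi> f = f"
  using ide_left[of f X "tgt C f"] by (simp add: in_hom_iff)

lemma ide_right_arr [simp]: "f \<in> Arr C \<Longrightarrow> tgt C f = X \<Longrightarrow> f \<Zsemi> \<one> X = f"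
  using ide_right[of f "src C f" X] by (simp add: in_hom_iff)

lemma inverse_arrows_unique:
  assumes "inverse_arrows C f g" "inverse_arrows C f h"
  shows "g = h"
proof -
  have "g = g \<Zsemi> (f \<Zsemi> h)"
    using assms by (simp add: inverse_arrows_def in_hom_iff)
  also have "\<dots> = (g \<Zsemi> f) \<Zsemi> h"
    using assms
    by (intro cmp_assoc_arr[symmetric]) (simp_all add: inverse_arrows_def in_hom_iff)
  also have "\<dots> = h"
    using assms by (simp add: inverse_arrows_def in_hom_iff)
  finally show ?thesis .
qed

lemma inv_arr_inverse: "iso C f \<Longrightarrow> inverse_arrows C f (inv_arr C f)"
  unfolding iso_def inv_arr_def by (metis inverse_arrows_unique the_equality)

lemma inv_arr_typ [simp]:
  assumes "iso C f"
  shows "inv_arr C f \<in> Arr C" "src C (inv_arr C f) = tgt C f" "tgt C (inv_arr C f) = src C f"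
  using inv_arr_inverse[OF assms] by (auto simp: inverse_arrows_def in_hom_iff)

lemma inv_arr_cmp [simp]:
  assumes "iso C f"
  shows "f \<Zsemi> inv_arr C f = \<one> (src C f)" "inv_arr C f \<Zsemi> f = \<one> (tgt C f)"
  using inv_arr_inverse[OF assms] by (auto simp: inverse_arrows_def)

lemma iso_in_Arr: "iso C f \<Longrightarrow> f \<in> Arr C"
  by (auto simp: iso_def inverse_arrows_def)

lemma iso_cancel_right:
  assumes "iso C k" "f \<in> Arr C" "g \<in> Arr C" "tgt C f = src C k" "tgt C g = src C k"
    and "f \<Zsemi> k = g \<Zsemi> k"
  shows "f = g"
proof -
  have "f = (f \<Zsemi> k) \<Zsemi> inv_arr C k"
    using assms(1-5) by (simp add: cmp_assoc_arr iso_in_Arr)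
  also have "\<dots> = g"
    unfolding assms(6) using assms(1-5) by (simp add: cmp_assoc_arr iso_in_Arr)
  finally show ?thesis .
qed

lemma iso_cancel_left:
  assumes "iso C k" "f \<in> Arr C" "g \<in> Arr C" "src C f = tgt C k" "src C g = tgt C k"
    and "k \<Zsemi> f = k \<Zsemi> g"
  shows "f = g"
proof -
  have "f = inv_arr C k \<Zsemi> (k \<Zsemi> f)"
    using assms(1-5) by (simp add: cmp_assoc_arr[symmetric] iso_in_Arr)
  also have "\<dots> = g"
    unfolding assms(6) using assms(1-5) by (simp add: cmp_assoc_arr[symmetric] iso_in_Arr)
  finally show ?thesis .
qed

end

section \<open>Coherence\<close>

context monoidal_category
begin

declare tens_Obj [simp] unit_Obj [simp] asso_iso [simp] lunit_iso [simp] runit_iso [simp]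

lemma tensA_typ [simp]:
  assumes "f \<in> Arr C" "g \<in> Arr C"
  shows "f \<otimes>\<^sub>a g \<in> Arr C" "src C (f \<otimes>\<^sub>a g) = src C f \<otimes> src C g"
    "tgt C (f \<otimes>\<^sub>a g) = tgt C f \<otimes> tgt C g"
  using tensA_hom[of f "src C f" "tgt C f" g "src C g" "tgt C g"] assms
  by (simp_all add: in_hom_iff)

lemma asso_typ [simp]:
  assumes "X \<in> Obj C" "Y \<in> Obj C" "Z \<in> Obj C"
  shows "asso C X Y Z \<in> Arr C" "src C (asso C X Y Z) = (X \<otimes> Y) \<otimes> Z"
    "tgt C (asso C X Y Z) = X \<otimes> (Y \<otimes> Z)"
  using asso_hom[OF assms] by (simp_all add: in_hom_iff)

lemma lunit_typ [simp]:
  assumes "X \<in> Obj C"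
  shows "lunit C X \<in> Arr C" "src C (lunit C X) = \<I> \<otimes> X" "tgt C (lunit C X) = X"
  using lunit_hom[OF assms] by (simp_all add: in_hom_iff)

lemma runit_typ [simp]:
  assumes "X \<in> Obj C"
  shows "runit C X \<in> Arr C" "src C (runit C X) = X \<otimes> \<I>" "tgt C (runit C X) = X"
  using runit_hom[OF assms] by (simp_all add: in_hom_iff)

lemma tensA_cmp_arr:
  assumes "f \<in> Arr C" "f' \<in> Arr C" "g \<in> Arr C" "g' \<in> Arr C"
    and "tgt C f = src C f'" "tgt C g = src C g'"
  shows "(f \<otimes>\<^sub>a g) \<Zsemi> (f' \<otimes>\<^sub>a g') = (f \<Zsemi> f') \<otimes>\<^sub>a (g \<Zsemi> g')"
  using tensA_cmp[of f "src C f" "src C f'" f' "tgt C f'" g "src C g" "src C g'" g' "tgt C g'"] assms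
  by (simp add: in_hom_iff)

text \<open>Composites are rebracketed to the right, so two tensors to be merged by interchange are
  often followed by a tail \<open>k\<close>.\<close>

lemma tensA_cmp_arr_left:
  assumes "f \<in> Arr C" "f' \<in> Arr C" "g \<in> Arr C" "g' \<in> Arr C" "k \<in> Arr C"
    and "tgt C f = src C f'" "tgt C g = src C g'" "src C k = tgt C f' \<otimes> tgt C g'"
  shows "(f \<otimes>\<^sub>a g) \<Zsemi> ((f' \<otimes>\<^sub>a g') \<Zsemi> k) = ((f \<Zsemi> f') \<otimes>\<^sub>a (g \<Zsemi> g')) \<Zsemi> k"
  using assms by (simp add: tensA_cmp_arr[symmetric] cmp_assoc_arr)

lemma asso_natural_arr:
  assumes "f \<in> Arr C" "g \<in> Arr C" "h \<in> Arr C" "tgt C f = X" "tgt C g = Y" "tgt C h = Z"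
  shows "((f \<otimes>\<^sub>a g) \<otimes>\<^sub>a h) \<Zsemi> asso C X Y Z
    = asso C (src C f) (src C g) (src C h) \<Zsemi> (f \<otimes>\<^sub>a (g \<otimes>\<^sub>a h))"
  using asso_natural[of f "src C f" X g "src C g" Y h "src C h" Z] assms
  by (simp add: in_hom_iff)

text \<open>The right unitor is a natural isomorphism, so an arrow can be recovered from its tensor
  with the unit.\<close>

lemma tensA_unit_faithful:
  assumes "f \<in> hom C X Y" "g \<in> hom C X Y" "f \<otimes>\<^sub>a \<one> \<I> = g \<otimes>\<^sub>a \<one> \<I>"
  shows "f = g"
proof -
  have "X \<in> Obj C"
    using assms(1) src_Obj by (auto simp: in_hom_iff)
  moreover have "runit C X \<Zsemi> f = runit C X \<Zsemi> g"
    using runit_natural[OF assms(1)] runit_natural[OF assms(2)] assms(3) by simp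
  ultimately show ?thesis
    using iso_cancel_left[of "runit C X" f g] assms(1,2) by (simp add: in_hom_iff)
qed

text \<open>Kelly's argument: tensor with the unit and cancel an associator in the pentagon.\<close>

lemma asso_runit:
  assumes [simp]: "X \<in> Obj C" "Y \<in> Obj C"
  shows "asso C X Y \<I> \<Zsemi> (\<one> X \<otimes>\<^sub>a runit C Y) = runit C (X \<otimes> Y)"
proof -
  let ?k = "\<one> X \<otimes>\<^sub>a (\<one> Y \<otimes>\<^sub>a lunit C \<I>)"
  have "(runit C (X \<otimes> Y) \<otimes>\<^sub>a \<one> \<I>) \<Zsemi> asso C X Y \<I>
      = asso C (X \<otimes> Y) \<I> \<I> \<Zsemi> (((\<one> X \<otimes>\<^sub>a \<one> Y) \<otimes>\<^sub>a lunit C \<I>) \<Zsemi> asso C X Y \<I>)"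
    by (simp add: triangle[symmetric] tensA_ide cmp_assoc_arr)
  also have "\<dots> = (asso C (X \<otimes> Y) \<I> \<I> \<Zsemi> asso C X Y (\<I> \<otimes> \<I>)) \<Zsemi> ?k"
    by (simp add: asso_natural_arr cmp_assoc_arr)
  \<comment> \<open>The pentagon for \<open>X\<close>, \<open>Y\<close>, \<open>\<I>\<close>,
    \<open>\<I>\<close> produces \<open>asso C Y \<I> \<I>\<close> in the second factor, where the
    triangle turns \<open>lunit C \<I>\<close> into \<open>runit C Y\<close>.\<close>
  also have "\<dots> = (asso C X Y \<I> \<otimes>\<^sub>a \<one> \<I>) \<Zsemi> (asso C X (Y \<otimes> \<I>) \<I> \<Zsemi> (\<one> X \<otimes>\<^sub>a (runit C Y \<otimes>\<^sub>a \<one> \<I>)))"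
    by (simp add: pentagon cmp_assoc_arr tensA_cmp_arr triangle)
  also have "\<dots> = ((asso C X Y \<I> \<Zsemi> (\<one> X \<otimes>\<^sub>a runit C Y)) \<otimes>\<^sub>a \<one> \<I>) \<Zsemi> asso C X Y \<I>"
  proof -
    have "asso C X (Y \<otimes> \<I>) \<I> \<Zsemi> (\<one> X \<otimes>\<^sub>a (runit C Y \<otimes>\<^sub>a \<one> \<I>))
        = ((\<one> X \<otimes>\<^sub>a runit C Y) \<otimes>\<^sub>a \<one> \<I>) \<Zsemi> asso C X Y \<I>"
      by (simp add: asso_natural_arr)
    then show ?thesis
      by (simp only:) (simp add: tensA_cmp_arr_left)
  qed
  finally have "runit C (X \<otimes> Y) \<otimes>\<^sub>a \<one> \<I> = (asso C X Y \<I> \<Zsemi> (\<one> X \<otimes>\<^sub>a runit C Y)) \<otimes>\<^sub>a \<one> \<I>"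
    by (rule iso_cancel_right[rotated 5]) simp_all
  from tensA_unit_faithful[OF _ _ this, of "(X \<otimes> Y) \<otimes> \<I>" "X \<otimes> Y"] show ?thesis
    by (simp add: in_hom_iff)
qed

end

section \<open>Symmetry and the exchange of the last two factors\<close>

context symmetric_monoidal_category
begin

lemma sym_typ [simp]:
  assumes "X \<in> Obj C" "Y \<in> Obj C"
  shows "sym C X Y \<in> Arr C" "src C (sym C X Y) = X \<otimes> Y" "tgt C (sym C X Y) = Y \<otimes> X"
  using sym_hom[OF assms] by (simp_all add: in_hom_iff)

lemma sym_natural_arr:
  assumes "f \<in> Arr C" "g \<in> Arr C" "tgt C f = X" "tgt C g = Y"
  shows "(f \<otimes>\<^sub>a g) \<Zsemi> sym C X Y = sym C (src C f) (src C g) \<Zsemi> (g \<otimes>\<^sub>a f)"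
  using sym_natural[of f "src C f" X g "src C g" Y] assms by (simp add: in_hom_iff)

lemma right_swap_typ [simp]:
  assumes "X \<in> Obj C" "Y \<in> Obj C" "Z \<in> Obj C"
  shows "right_swap C X Y Z \<in> Arr C" "src C (right_swap C X Y Z) = (X \<otimes> Y) \<otimes> Z"
    "tgt C (right_swap C X Y Z) = (X \<otimes> Z) \<otimes> Y"
  using assms by (simp_all add: right_swap_def)

text \<open>\<open>right_swap\<close> ends in an inverse associator. After composition with
  \<open>asso C X Z Y\<close>, naturality of the associator and of the symmetry suffices, and the
  associator is then cancelled.\<close>

lemma right_swap_natural:
  assumes [simp]: "f \<in> Arr C" "g \<in> Arr C" "h \<in> Arr C" "tgt C f = X" "tgt C g = Y" "tgt C h = Z"
  shows "((f \<otimes>\<^sub>a g) \<otimes>\<^sub>a h) \<Zsemi> right_swap C X Y Z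
    = right_swap C (src C f) (src C g) (src C h) \<Zsemi> ((f \<otimes>\<^sub>a h) \<otimes>\<^sub>a g)"
proof -
  have [simp]: "X \<in> Obj C" "Y \<in> Obj C" "Z \<in> Obj C"
    "src C f \<in> Obj C" "src C g \<in> Obj C" "src C h \<in> Obj C"
    using src_Obj tgt_Obj assms by blast+
  let ?A = "asso C (src C f) (src C g) (src C h)"
  have "((f \<otimes>\<^sub>a g) \<otimes>\<^sub>a h) \<Zsemi> right_swap C X Y Z \<Zsemi> asso C X Z Y
      = (((f \<otimes>\<^sub>a g) \<otimes>\<^sub>a h) \<Zsemi> asso C X Y Z) \<Zsemi> (\<one> X \<otimes>\<^sub>a sym C Y Z)"
    by (simp add: right_swap_def cmp_assoc_arr)
  also have "\<dots> = ?A \<Zsemi> (f \<otimes>\<^sub>a (sym C (src C g) (src C h) \<Zsemi> (h \<otimes>\<^sub>a g)))"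
    by (simp add: asso_natural_arr cmp_assoc_arr tensA_cmp_arr sym_natural_arr)
  also have "\<dots> = right_swap C (src C f) (src C g) (src C h) \<Zsemi>
      (asso C (src C f) (src C h) (src C g) \<Zsemi> (f \<otimes>\<^sub>a (h \<otimes>\<^sub>a g)))"
  proof -
    have "inv_arr C (asso C (src C f) (src C h) (src C g)) \<Zsemi>
        (asso C (src C f) (src C h) (src C g) \<Zsemi> (f \<otimes>\<^sub>a (h \<otimes>\<^sub>a g))) = f \<otimes>\<^sub>a (h \<otimes>\<^sub>a g)"
      by (simp add: cmp_assoc_arr[symmetric])
    then show ?thesis
      by (simp add: right_swap_def cmp_assoc_arr tensA_cmp_arr)
  qed
  also have "\<dots> = right_swap C (src C f) (src C g) (src C h) \<Zsemi> ((f \<otimes>\<^sub>a h) \<otimes>\<^sub>a g) \<Zsemi> asso C X Z Y"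
    by (simp add: asso_natural_arr cmp_assoc_arr)
  finally show ?thesis
    by (rule iso_cancel_right[rotated 5]) simp_all
qed

text \<open>The hexagon with its last associator moved to the other side: carrying \<open>Y\<close>
  past \<open>X\<close> and then past \<open>Z\<close> is carrying it past
  \<open>X \<otimes> Z\<close>.\<close>

lemma sym_right_swap:
  assumes [simp]: "X \<in> Obj C" "Y \<in> Obj C" "Z \<in> Obj C"
  shows "(sym C Y X \<otimes>\<^sub>a \<one> Z) \<Zsemi> right_swap C X Y Z = asso C Y X Z \<Zsemi> sym C Y (X \<otimes> Z)"
proof -
  have "(sym C Y X \<otimes>\<^sub>a \<one> Z) \<Zsemi> right_swap C X Y Z
      = ((sym C Y X \<otimes>\<^sub>a \<one> Z) \<Zsemi> asso C X Y Z \<Zsemi> (\<one> X \<otimes>\<^sub>a sym C Y Z)) \<Zsemi> inv_arr C (asso C X Z Y)"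
    by (simp add: right_swap_def cmp_assoc_arr)
  also have "\<dots> = asso C Y X Z \<Zsemi> sym C Y (X \<otimes> Z)"
    unfolding hexagon[OF assms(2,1,3), symmetric] by (simp add: cmp_assoc_arr)
  finally show ?thesis .
qed

end

section \<open>The copied marginal\<close>

context markov_category
begin

lemma copy_typ [simp]:
  assumes "X \<in> Obj C"
  shows "\<delta> X \<in> Arr C" "src C (\<delta> X) = X" "tgt C (\<delta> X) = X \<otimes> X"
  using copy_hom[OF assms] by (simp_all add: in_hom_iff)

lemma del_typ [simp]:
  assumes "X \<in> Obj C"
  shows "\<epsilon> X \<in> Arr C" "src C (\<epsilon> X) = X" "tgt C (\<epsilon> X) = \<I>"
  using del_hom[OF assms] by (simp_all add: in_hom_iff)

lemma del_natural_arr: "f \<in> Arr C \<Longrightarrow> tgt C f = Y \<Longrightarrow> f \<Zsemi> \<epsilon> Y = \<epsilon> (src C f)"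
  using del_natural[of f "src C f" Y] by (simp add: in_hom_iff)

text \<open>The part of \<open>tri\<close> that precedes \<open>g\<close>, without the wire
  \<open>X\<close>. Informally it sends a to (b, (a, b)), where b is one output of \<open>f\<close>,
  copied. Equations f \<triangleleft> g = f \<triangleleft> h thus compare two continuations of one
  arrow.\<close>

definition graph :: "'a \<Rightarrow> 'a" where
  "graph f = (let A = src C f; B = tgt C f in
     \<delta> A \<Zsemi> (\<one> A \<otimes>\<^sub>a (f \<Zsemi> \<delta> B)) \<Zsemi> inv_arr C (asso C A B B) \<Zsemi> sym C (A \<otimes> B) B)"

lemma graph_typ [simp]:
  assumes "f \<in> Arr C"
  shows "graph f \<in> Arr C" "src C (graph f) = src C f"
    "tgt C (graph f) = tgt C f \<otimes> (src C f \<otimes> tgt C f)"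
  using assms src_Obj[OF assms] tgt_Obj[OF assms] by (simp_all add: graph_def Let_def)

lemma tri_eq_graph:
  assumes f: "f \<in> hom C A B" and [simp]: "X \<in> Obj C" and g: "g \<in> hom C ((A \<otimes> B) \<otimes> X) Y"
  shows "tri C f X g = (graph f \<otimes>\<^sub>a \<one> X) \<Zsemi> (asso C B (A \<otimes> B) X \<Zsemi> (\<one> B \<otimes>\<^sub>a g))"
proof -
  have [simp]: "f \<in> Arr C" "src C f = A" "tgt C f = B" "A \<in> Obj C" "B \<in> Obj C"
    "g \<in> Arr C" "src C g = (A \<otimes> B) \<otimes> X"
    using f g src_Obj[of f] tgt_Obj[of f] by (auto simp: in_hom_iff)
  show ?thesis
    by (simp add: tri_def graph_def Let_def cmp_assoc_arr tensA_cmp_arr_left)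
qed

text \<open>The unitors cancel: \<open>asso_runit\<close> merges the inner one with the associator
  into the unitor of \<open>B \<otimes> (A \<otimes> B)\<close>, and naturality moves that one in
  front of \<open>graph f\<close>, next to its inverse.\<close>

lemma tri_unit_eq_graph:
  assumes f: "f \<in> hom C A B" and g: "g \<in> hom C (A \<otimes> B) Y"
  shows "tri_unit C f g = graph f \<Zsemi> (\<one> B \<otimes>\<^sub>a g)"
proof -
  have [simp]: "f \<in> Arr C" "src C f = A" "tgt C f = B" "A \<in> Obj C" "B \<in> Obj C"
    "g \<in> Arr C" "src C g = A \<otimes> B"
    using f g src_Obj[of f] tgt_Obj[of f] by (auto simp: in_hom_iff)
  have rg: "runit C (A \<otimes> B) \<Zsemi> g \<in> hom C ((A \<otimes> B) \<otimes> \<I>) Y"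
    using g by (simp add: in_hom_iff)
  have "asso C B (A \<otimes> B) \<I> \<Zsemi> (\<one> B \<otimes>\<^sub>a (runit C (A \<otimes> B) \<Zsemi> g))
      = (asso C B (A \<otimes> B) \<I> \<Zsemi> (\<one> B \<otimes>\<^sub>a runit C (A \<otimes> B))) \<Zsemi> (\<one> B \<otimes>\<^sub>a g)"
    by (simp add: cmp_assoc_arr tensA_cmp_arr)
  also have "\<dots> = runit C (B \<otimes> (A \<otimes> B)) \<Zsemi> (\<one> B \<otimes>\<^sub>a g)"
    by (simp add: asso_runit)
  finally have "tri_unit C f g = inv_arr C (runit C A) \<Zsemi>
      (((graph f \<otimes>\<^sub>a \<one> \<I>) \<Zsemi> runit C (B \<otimes> (A \<otimes> B))) \<Zsemi> (\<one> B \<otimes>\<^sub>a g))"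
    by (simp add: tri_unit_def tri_eq_graph[OF f _ rg] cmp_assoc_arr)
  also have "\<dots> = inv_arr C (runit C A) \<Zsemi> ((runit C A \<Zsemi> graph f) \<Zsemi> (\<one> B \<otimes>\<^sub>a g))"
    using runit_natural[of "graph f" A "B \<otimes> (A \<otimes> B)"] by (simp add: in_hom_iff)
  also have "\<dots> = (inv_arr C (runit C A) \<Zsemi> runit C A) \<Zsemi> (graph f \<Zsemi> (\<one> B \<otimes>\<^sub>a g))"
    by (simp add: cmp_assoc_arr del: inv_arr_cmp)
  also have "\<dots> = graph f \<Zsemi> (\<one> B \<otimes>\<^sub>a g)"
    by simp
  finally show ?thesis .
qed

text \<open>\<open>graph f\<close> with the kept output moved last, which makes it a representative
  in the coend with W = \<open>src C f \<otimes> tgt C f\<close>.\<close>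

definition copied :: "'a \<Rightarrow> 'a" where
  "copied f = graph f \<Zsemi> sym C (tgt C f) (src C f \<otimes> tgt C f)"

lemma copied_typ [simp]:
  assumes "f \<in> Arr C"
  shows "copied f \<in> Arr C" "src C (copied f) = src C f"
    "tgt C (copied f) = (src C f \<otimes> tgt C f) \<otimes> tgt C f"
  using assms src_Obj[OF assms] tgt_Obj[OF assms] by (simp_all add: copied_def)

text \<open>\<open>sym C \<I> Q \<Zsemi> runit C Q\<close> acts as the left unitor. It has this form
  because \<open>has_conditionals\<close> discards the right factor: naturality of the symmetry
  turns the marginal of \<open>h \<Zsemi> sym C W Q\<close> into exactly this composite.\<close>

definition marginal :: "'o \<Rightarrow> 'o \<Rightarrow> 'a \<Rightarrow> 'a" where
  "marginal W Q h = h \<Zsemi> (\<epsilon> W \<otimes>\<^sub>a \<one> Q) \<Zsemi> sym C \<I> Q \<Zsemi> runit C Q"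

lemma marginal_hom:
  assumes "W \<in> Obj C" "Q \<in> Obj C" "h \<in> hom C P (W \<otimes> Q)"
  shows "marginal W Q h \<in> hom C P Q"
  using assms by (simp add: marginal_def in_hom_iff)

text \<open>Discarding absorbs \<open>r\<close> by naturality of \<open>\<epsilon>\<close>. Hence
  marginals are invariant under the generating steps of the coend.\<close>

lemma marginal_cmp:
  assumes "W \<in> Obj C" "Q \<in> Obj C" "h \<in> hom C P (W \<otimes> Q)" "r \<in> hom C W W'"
  shows "marginal W' Q (h \<Zsemi> (r \<otimes>\<^sub>a \<one> Q)) = marginal W Q h"
proof -
  have [simp]: "W' \<in> Obj C"
    using assms(4) tgt_Obj by (auto simp: in_hom_iff)
  show ?thesis
    using assms
    by (simp add: marginal_def in_hom_iff cmp_assoc_arr tensA_cmp_arr_left del_natural_arr)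
qed

text \<open>The symmetry and the unitor at the end of \<open>marginal\<close> are invertible, so
  they can be cancelled.\<close>

lemma marginal_eq_iff:
  assumes "W \<in> Obj C" "W' \<in> Obj C" "Q \<in> Obj C" "h \<in> hom C P (W \<otimes> Q)" "h' \<in> hom C P (W' \<otimes> Q)"
  shows "marginal W Q h = marginal W' Q h' \<longleftrightarrow>
    h \<Zsemi> (\<epsilon> W \<otimes>\<^sub>a \<one> Q) = h' \<Zsemi> (\<epsilon> W' \<otimes>\<^sub>a \<one> Q)"
proof
  have sym_iso: "iso C (sym C \<I> Q)"
    using assms sym_sym[of \<I> Q] sym_sym[of Q \<I>]
    by (auto simp: iso_def inverse_arrows_def in_hom_iff intro!: exI[of _ "sym C Q \<I>"])
  assume "marginal W Q h = marginal W' Q h'"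
  then have "h \<Zsemi> (\<epsilon> W \<otimes>\<^sub>a \<one> Q) \<Zsemi> sym C \<I> Q = h' \<Zsemi> (\<epsilon> W' \<otimes>\<^sub>a \<one> Q) \<Zsemi> sym C \<I> Q"
    unfolding marginal_def
    by (rule iso_cancel_right[rotated 5]) (use assms in \<open>simp_all add: in_hom_iff\<close>)
  then show "h \<Zsemi> (\<epsilon> W \<otimes>\<^sub>a \<one> Q) = h' \<Zsemi> (\<epsilon> W' \<otimes>\<^sub>a \<one> Q)"
    by (rule iso_cancel_right[rotated 5]) (use assms sym_iso in \<open>simp_all add: in_hom_iff\<close>)
qed (simp add: marginal_def)

text \<open>\<open>c\<close> is a conditional of \<open>h\<close> given its output in
  \<open>Q\<close>. Since \<open>has_conditionals\<close> retains the first factor, it is applied to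
  \<open>h \<Zsemi> sym C W Q\<close>; swapping back puts the conditional on the first
  factor.\<close>

lemma copied_factorisation:
  assumes "has_conditionals C"
    and [simp]: "W \<in> Obj C" "Q \<in> Obj C" and h: "h \<in> hom C P (W \<otimes> Q)"
  obtains c where "c \<in> hom C (P \<otimes> Q) W" "h = copied (marginal W Q h) \<Zsemi> (c \<otimes>\<^sub>a \<one> Q)"
proof -
  let ?m = "marginal W Q h"
  have [simp]: "h \<in> Arr C" "src C h = P" "tgt C h = W \<otimes> Q" "P \<in> Obj C"
    using h src_Obj by (auto simp: in_hom_iff)
  have m: "?m \<in> hom C P Q"
    using marginal_hom[OF assms(2-4)] .
  have [simp]: "?m \<in> Arr C" "src C ?m = P" "tgt C ?m = Q"
    using m by (auto simp: in_hom_iff)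
  have m_eq: "h \<Zsemi> sym C W Q \<Zsemi> (\<one> Q \<otimes>\<^sub>a \<epsilon> W) \<Zsemi> runit C Q = ?m"
  proof -
    have "sym C W Q \<Zsemi> (\<one> Q \<otimes>\<^sub>a \<epsilon> W) = (\<epsilon> W \<otimes>\<^sub>a \<one> Q) \<Zsemi> sym C \<I> Q"
      by (simp add: sym_natural_arr)
    then have "h \<Zsemi> (sym C W Q \<Zsemi> (\<one> Q \<otimes>\<^sub>a \<epsilon> W)) \<Zsemi> runit C Q
        = h \<Zsemi> ((\<epsilon> W \<otimes>\<^sub>a \<one> Q) \<Zsemi> sym C \<I> Q) \<Zsemi> runit C Q"
      by simp
    then show ?thesis
      by (simp add: marginal_def cmp_assoc_arr)
  qed
  have "h \<Zsemi> sym C W Q \<in> hom C P (Q \<otimes> W)"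
    by (simp add: in_hom_iff)
  then obtain c where c: "c \<in> hom C (Q \<otimes> P) W"
    and hc: "h \<Zsemi> sym C W Q = tri_unit C ?m (sym C P Q \<Zsemi> c)"
    using assms(1) unfolding has_conditionals_def m_eq[symmetric] by fastforce
  \<comment> \<open>The conditional reads \<open>Q \<otimes> P\<close>, whereas \<open>graph\<close>
    supplies \<open>P \<otimes> Q\<close>.\<close>
  let ?g = "sym C P Q \<Zsemi> c"
  have g: "?g \<in> hom C (P \<otimes> Q) W"
    using c by (simp add: in_hom_iff)
  then have [simp]: "?g \<in> Arr C" "src C ?g = P \<otimes> Q" "tgt C ?g = W"
    by (simp_all only: in_hom_iff)
  have "h = h \<Zsemi> sym C W Q \<Zsemi> sym C Q W"
    by (simp add: cmp_assoc_arr sym_sym)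
  also have "\<dots> = graph ?m \<Zsemi> ((\<one> Q \<otimes>\<^sub>a ?g) \<Zsemi> sym C Q W)"
    unfolding hc tri_unit_eq_graph[OF m g] by (simp add: cmp_assoc_arr)
  also have "\<dots> = copied ?m \<Zsemi> (?g \<otimes>\<^sub>a \<one> Q)"
    by (simp add: copied_def cmp_assoc_arr sym_natural_arr)
  finally show ?thesis
    using that[OF g] by blast
qed

section \<open>Coend classes are marginals\<close>

text \<open>Induction along the zigzag: each link preserves the marginal by
  \<open>marginal_cmp\<close>, in whichever direction it is traversed.\<close>

lemma coend_rel_marginal:
  assumes "Q \<in> Obj C" "((W, h), (W', h')) \<in> coend_rel C P Q"
  shows "marginal W Q h = marginal W' Q h'"
proof -
  have "((W, h), (W', h')) \<in> (coend_step C P Q \<union> (coend_step C P Q)\<inverse>)\<^sup>*"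
    using assms(2) by (simp add: coend_rel_def)
  then show ?thesis
  proof (induction rule: rtrancl_induct2)
    case (step W1 h1 W2 h2)
    moreover have "marginal V Q k = marginal V' Q k'"
      if "((V, k), (V', k')) \<in> coend_step C P Q" for V k V' k'
      using that assms(1) by (auto simp: coend_step_def marginal_cmp)
    ultimately show ?case
      by (metis UnE converse_iff)
  qed simp
qed

lemma equiv_coend_rel: "equiv (coend_rep C P Q) (coend_rel C P Q)"
proof (rule equivI)
  let ?S = "coend_step C P Q \<union> (coend_step C P Q)\<inverse>"
  show "refl_on (coend_rep C P Q) (coend_rel C P Q)"
    by (auto simp: refl_on_def coend_rel_def)
  have "Relation.sym (?S\<^sup>*)"
    by (intro sym_rtrancl sym_Un_converse)
  then show "Relation.sym (coend_rel C P Q)"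
    unfolding coend_rel_def Relation.sym_def by blast
  show "trans (coend_rel C P Q)"
    unfolding coend_rel_def by (rule transI) (auto intro: rtrancl_trans)
qed (auto simp: coend_rel_def)

text \<open>By \<open>copied_factorisation\<close> every representative is one generating step away
  from its copied marginal. Equal marginals therefore give a zigzag of length two through a common
  representative.\<close>

lemma coend_class_eq_iff:
  assumes "has_conditionals C" "Q \<in> Obj C" "W \<in> Obj C" "W' \<in> Obj C"
    and h: "h \<in> hom C P (W \<otimes> Q)" and h': "h' \<in> hom C P (W' \<otimes> Q)"
  shows "coend_class C P Q W h = coend_class C P Q W' h' \<longleftrightarrow> marginal W Q h = marginal W' Q h'"
proof -
  have rep: "(W, h) \<in> coend_rep C P Q" "(W', h') \<in> coend_rep C P Q"
    using assms by (auto simp: coend_rep_def)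
  have step: "((V, k), (P \<otimes> Q, copied (marginal V Q k))) \<in> coend_step C P Q"
    if V: "V \<in> Obj C" and k: "k \<in> hom C P (V \<otimes> Q)" for V k
  proof -
    have "P \<in> Obj C"
      using V k src_Obj by (auto simp: in_hom_iff)
    moreover have "copied (marginal V Q k) \<in> hom C P ((P \<otimes> Q) \<otimes> Q)"
      using marginal_hom[OF V assms(2) k] by (simp add: in_hom_iff)
    moreover obtain c where "c \<in> hom C (P \<otimes> Q) V" "k = copied (marginal V Q k) \<Zsemi> (c \<otimes>\<^sub>a \<one> Q)"
      using copied_factorisation[OF assms(1) V assms(2) k] .
    ultimately show ?thesis
      unfolding coend_step_def using V k assms(2) by auto
  qed
  have "((W, h), (W', h')) \<in> coend_rel C P Q" if "marginal W Q h = marginal W' Q h'"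
  proof -
    let ?S = "coend_step C P Q \<union> (coend_step C P Q)\<inverse>"
    have "((W, h), (P \<otimes> Q, copied (marginal W Q h))) \<in> ?S"
      using step[OF assms(3) h] by simp
    moreover have "((P \<otimes> Q, copied (marginal W Q h)), (W', h')) \<in> ?S"
      using step[OF assms(4) h'] that by simp
    ultimately show ?thesis
      using rep unfolding coend_rel_def by (auto intro: rtrancl_trans)
  qed
  then show ?thesis
    unfolding coend_class_def
    using eq_equiv_class_iff[OF equiv_coend_rel rep] coend_rel_marginal[OF assms(2)] by blast
qed

section \<open>Plugging into the copied marginal\<close>

lemma plug_hom:
  assumes "M \<in> Obj C" "Y \<in> Obj C" "A \<in> Obj C" "U \<in> Obj C" "B \<in> Obj C"
    and "a \<in> hom C X (M \<otimes> Y)" "u \<in> hom C (M \<otimes> A) (U \<otimes> B)"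
  shows "plug C M Y A U B a u \<in> hom C (X \<otimes> A) (U \<otimes> (B \<otimes> Y))"
  using assms by (simp add: plug_def in_hom_iff)

text \<open>Discarding \<open>U\<close> in the plugged arrow gives f \<triangleleft> g up to
  isomorphisms that depend only on \<open>B\<close> and \<open>Y\<close>. Equal marginals of two
  plugged arrows thus become an equation to which a range applies.\<close>

lemma tri_eq_plug:
  assumes f: "f \<in> hom C X Y"
    and [simp]: "A \<in> Obj C" "U \<in> Obj C" "B \<in> Obj C"
    and c: "c \<in> hom C (X \<otimes> Y) M" and u: "u \<in> hom C (M \<otimes> A) (U \<otimes> B)"
  shows "tri C f A ((c \<otimes>\<^sub>a \<one> A) \<Zsemi> u \<Zsemi> (\<epsilon> U \<otimes>\<^sub>a \<one> B)) =
    plug C M Y A U B (copied f \<Zsemi> (c \<otimes>\<^sub>a \<one> Y)) u \<Zsemi> (\<epsilon> U \<otimes>\<^sub>a \<one> (B \<otimes> Y)) \<Zsemi>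
    inv_arr C (asso C \<I> B Y) \<Zsemi> sym C (\<I> \<otimes> B) Y"
proof -
  let ?N = "X \<otimes> Y"
  let ?e = "u \<Zsemi> (\<epsilon> U \<otimes>\<^sub>a \<one> B)"
  let ?g = "(c \<otimes>\<^sub>a \<one> A) \<Zsemi> ?e"
  have [simp]: "f \<in> Arr C" "src C f = X" "tgt C f = Y" "X \<in> Obj C" "Y \<in> Obj C"
    "c \<in> Arr C" "src C c = ?N" "tgt C c = M" "M \<in> Obj C"
    "u \<in> Arr C" "src C u = M \<otimes> A" "tgt C u = U \<otimes> B"
    using f c u src_Obj[of f] tgt_Obj[of f] tgt_Obj[of c] by (auto simp: in_hom_iff)
  \<comment> \<open>Slides \<open>c\<close> behind the exchange of \<open>Y\<close> and
    \<open>A\<close>, next to \<open>u\<close>.\<close>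
  have natural: "((c \<otimes>\<^sub>a \<one> Y) \<otimes>\<^sub>a \<one> A) \<Zsemi> right_swap C M Y A
      = right_swap C ?N Y A \<Zsemi> ((c \<otimes>\<^sub>a \<one> A) \<otimes>\<^sub>a \<one> Y)"
    by (simp add: right_swap_natural)
  have del: "asso C U B Y \<Zsemi> (\<epsilon> U \<otimes>\<^sub>a \<one> (B \<otimes> Y)) \<Zsemi> inv_arr C (asso C \<I> B Y)
      = (\<epsilon> U \<otimes>\<^sub>a \<one> B) \<otimes>\<^sub>a \<one> Y"
  proof -
    have "asso C U B Y \<Zsemi> (\<epsilon> U \<otimes>\<^sub>a \<one> (B \<otimes> Y)) = ((\<epsilon> U \<otimes>\<^sub>a \<one> B) \<otimes>\<^sub>a \<one> Y) \<Zsemi> asso C \<I> B Y"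
      by (simp add: asso_natural_arr tensA_ide)
    then show ?thesis
      by (simp add: cmp_assoc_arr)
  qed
  have "plug C M Y A U B (copied f \<Zsemi> (c \<otimes>\<^sub>a \<one> Y)) u \<Zsemi> (\<epsilon> U \<otimes>\<^sub>a \<one> (B \<otimes> Y)) \<Zsemi>
      inv_arr C (asso C \<I> B Y) \<Zsemi> sym C (\<I> \<otimes> B) Y
    = (copied f \<otimes>\<^sub>a \<one> A) \<Zsemi> (((c \<otimes>\<^sub>a \<one> Y) \<otimes>\<^sub>a \<one> A) \<Zsemi> right_swap C M Y A) \<Zsemi> (u \<otimes>\<^sub>a \<one> Y) \<Zsemi>
      (asso C U B Y \<Zsemi> (\<epsilon> U \<otimes>\<^sub>a \<one> (B \<otimes> Y)) \<Zsemi> inv_arr C (asso C \<I> B Y)) \<Zsemi> sym C (\<I> \<otimes> B) Y"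
    by (simp add: plug_def cmp_assoc_arr tensA_cmp_arr_left)
  also have "\<dots> = (copied f \<otimes>\<^sub>a \<one> A) \<Zsemi> right_swap C ?N Y A \<Zsemi> ((?g \<otimes>\<^sub>a \<one> Y) \<Zsemi> sym C (\<I> \<otimes> B) Y)"
    unfolding natural del by (simp add: cmp_assoc_arr tensA_cmp_arr_left)
  also have "\<dots> = (graph f \<otimes>\<^sub>a \<one> A) \<Zsemi> ((sym C Y ?N \<otimes>\<^sub>a \<one> A) \<Zsemi> right_swap C ?N Y A) \<Zsemi>
      sym C (?N \<otimes> A) Y \<Zsemi> (\<one> Y \<otimes>\<^sub>a ?g)"
    by (simp add: copied_def sym_natural_arr cmp_assoc_arr tensA_cmp_arr_left)
  \<comment> \<open>The swap inside \<open>copied\<close> and the \<open>right_swap\<close> of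
    \<open>plug\<close> together carry \<open>Y\<close> past \<open>?N \<otimes> A\<close>; the
    trailing symmetry is the inverse of this.\<close>
  also have "\<dots> = (graph f \<otimes>\<^sub>a \<one> A) \<Zsemi> asso C Y ?N A \<Zsemi> (sym C Y (?N \<otimes> A) \<Zsemi>
      sym C (?N \<otimes> A) Y) \<Zsemi> (\<one> Y \<otimes>\<^sub>a ?g)"
    by (simp add: sym_right_swap cmp_assoc_arr)
  also have "\<dots> = (graph f \<otimes>\<^sub>a \<one> A) \<Zsemi> (asso C Y ?N A \<Zsemi> (\<one> Y \<otimes>\<^sub>a ?g))"
    by (simp add: sym_sym cmp_assoc_arr)
  also have "\<dots> = tri C f A ?g"
    by (rule tri_eq_graph[symmetric, OF f]) (simp_all add: in_hom_iff)
  finally show ?thesis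
    by (simp add: cmp_assoc_arr)
qed

text \<open>The separation condition of productivity with coend classes replaced by marginals, for
  representatives given through conditionals \<open>c\<close> and \<open>d\<close>.\<close>

lemma range_marginal_eq:
  assumes f: "f \<in> hom C X Y" and r: "is_range C f r"
    and [simp]: "A \<in> Obj C" "B \<in> Obj C" "U \<in> Obj C" "V \<in> Obj C"
    and c: "c \<in> hom C (X \<otimes> Y) M" and u: "u \<in> hom C (M \<otimes> A) (U \<otimes> B)"
    and d: "d \<in> hom C (X \<otimes> Y) N" and v: "v \<in> hom C (N \<otimes> A) (V \<otimes> B)"
    and eq: "marginal U (B \<otimes> Y) (plug C M Y A U B (copied f \<Zsemi> (c \<otimes>\<^sub>a \<one> Y)) u)
      = marginal V (B \<otimes> Y) (plug C N Y A V B (copied f \<Zsemi> (d \<otimes>\<^sub>a \<one> Y)) v)"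
  shows "marginal U B (((r \<Zsemi> c) \<otimes>\<^sub>a \<one> A) \<Zsemi> u) = marginal V B (((r \<Zsemi> d) \<otimes>\<^sub>a \<one> A) \<Zsemi> v)"
proof -
  have [simp]: "f \<in> Arr C" "src C f = X" "tgt C f = Y" "X \<in> Obj C" "Y \<in> Obj C"
    "c \<in> Arr C" "src C c = X \<otimes> Y" "tgt C c = M" "M \<in> Obj C"
    "u \<in> Arr C" "src C u = M \<otimes> A" "tgt C u = U \<otimes> B"
    "d \<in> Arr C" "src C d = X \<otimes> Y" "tgt C d = N" "N \<in> Obj C"
    "v \<in> Arr C" "src C v = N \<otimes> A" "tgt C v = V \<otimes> B"
    using f c u d v src_Obj[of f] tgt_Obj[of f] tgt_Obj[of c] tgt_Obj[of d]
    by (auto simp: in_hom_iff)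
  have [simp]: "r \<in> Arr C" "src C r = X \<otimes> Y" "tgt C r = X \<otimes> Y"
    using r by (auto simp: is_range_def Let_def in_hom_iff)
  \<comment> \<open>\<open>U\<close> and \<open>V\<close> may differ. Discarding them makes
    \<open>?g\<close> and \<open>?h\<close> parallel arrows into \<open>\<I> \<otimes> B\<close>, as
    the cancellation property of the range requires.\<close>
  let ?g = "(c \<otimes>\<^sub>a \<one> A) \<Zsemi> u \<Zsemi> (\<epsilon> U \<otimes>\<^sub>a \<one> B)"
  let ?h = "(d \<otimes>\<^sub>a \<one> A) \<Zsemi> v \<Zsemi> (\<epsilon> V \<otimes>\<^sub>a \<one> B)"
  have "copied f \<Zsemi> (c \<otimes>\<^sub>a \<one> Y) \<in> hom C X (M \<otimes> Y)" "copied f \<Zsemi> (d \<otimes>\<^sub>a \<one> Y) \<in> hom C X (N \<otimes> Y)"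
    by (simp_all add: in_hom_iff)
  then have "plug C M Y A U B (copied f \<Zsemi> (c \<otimes>\<^sub>a \<one> Y)) u \<Zsemi> (\<epsilon> U \<otimes>\<^sub>a \<one> (B \<otimes> Y))
      = plug C N Y A V B (copied f \<Zsemi> (d \<otimes>\<^sub>a \<one> Y)) v \<Zsemi> (\<epsilon> V \<otimes>\<^sub>a \<one> (B \<otimes> Y))"
    using eq u v by (subst (asm) marginal_eq_iff) (auto intro: plug_hom)
  then have "tri C f A ?g = tri C f A ?h"
    using tri_eq_plug[OF f _ _ _ c u] tri_eq_plug[OF f _ _ _ d v] by simp
  moreover have "?g \<in> hom C ((X \<otimes> Y) \<otimes> A) (\<I> \<otimes> B)" "?h \<in> hom C ((X \<otimes> Y) \<otimes> A) (\<I> \<otimes> B)"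
    by (simp_all add: in_hom_iff)
  moreover have "\<I> \<otimes> B \<in> Obj C"
    by simp
  ultimately have "(r \<otimes>\<^sub>a \<one> A) \<Zsemi> ?g = (r \<otimes>\<^sub>a \<one> A) \<Zsemi> ?h"
    using r \<open>A \<in> Obj C\<close> unfolding is_range_def Let_def by (metis \<open>src C f = X\<close> \<open>tgt C f = Y\<close>)
  then have "((r \<Zsemi> c) \<otimes>\<^sub>a \<one> A) \<Zsemi> u \<Zsemi> (\<epsilon> U \<otimes>\<^sub>a \<one> B) = ((r \<Zsemi> d) \<otimes>\<^sub>a \<one> A) \<Zsemi> v \<Zsemi> (\<epsilon> V \<otimes>\<^sub>a \<one> B)"
    by (simp add: cmp_assoc_arr tensA_cmp_arr_left)
  then show ?thesis
    by (subst marginal_eq_iff[where P = "(X \<otimes> Y) \<otimes> A"]) (simp_all add: in_hom_iff)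
qed

text \<open>The equation f \<triangleleft> id = f \<triangleleft> r says that \<open>graph f\<close>
  absorbs \<open>r\<close> on its second factor. So precomposing a conditional with \<open>r\<close>
  leaves the represented arrow unchanged.\<close>

lemma copied_range:
  assumes f: "f \<in> hom C X Y" and r: "is_range C f r" and c: "c \<in> hom C (X \<otimes> Y) M"
  shows "copied f \<Zsemi> ((r \<Zsemi> c) \<otimes>\<^sub>a \<one> Y) = copied f \<Zsemi> (c \<otimes>\<^sub>a \<one> Y)"
proof -
  have [simp]: "f \<in> Arr C" "src C f = X" "tgt C f = Y" "X \<in> Obj C" "Y \<in> Obj C"
    "c \<in> Arr C" "src C c = X \<otimes> Y" "tgt C c = M" "M \<in> Obj C"
    using f c src_Obj[of f] tgt_Obj[of f] tgt_Obj[of c] by (auto simp: in_hom_iff)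
  have r_hom: "r \<in> hom C (X \<otimes> Y) (X \<otimes> Y)"
    and r_tri: "tri_unit C f (\<one> (X \<otimes> Y)) = tri_unit C f r"
    using r by (auto simp: is_range_def Let_def)
  then have [simp]: "r \<in> Arr C" "src C r = X \<otimes> Y" "tgt C r = X \<otimes> Y"
    by (auto simp: in_hom_iff)
  have "graph f \<Zsemi> (\<one> Y \<otimes>\<^sub>a r) = graph f \<Zsemi> (\<one> Y \<otimes>\<^sub>a \<one> (X \<otimes> Y))"
    using r_tri tri_unit_eq_graph[OF f r_hom]
      tri_unit_eq_graph[OF f ide_hom[OF tens_Obj[of X Y]]] by simp
  also have "\<dots> = graph f"
    by (simp add: tensA_ide)
  finally have graph_r: "graph f \<Zsemi> (\<one> Y \<otimes>\<^sub>a r) = graph f" .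
  have "copied f \<Zsemi> (c \<otimes>\<^sub>a \<one> Y) = (graph f \<Zsemi> (\<one> Y \<otimes>\<^sub>a r)) \<Zsemi> (sym C Y (X \<otimes> Y) \<Zsemi> (c \<otimes>\<^sub>a \<one> Y))"
    unfolding graph_r by (simp add: copied_def cmp_assoc_arr)
  also have "\<dots> = graph f \<Zsemi> ((\<one> Y \<otimes>\<^sub>a r) \<Zsemi> sym C Y (X \<otimes> Y)) \<Zsemi> (c \<otimes>\<^sub>a \<one> Y)"
    by (simp add: cmp_assoc_arr)
  also have "\<dots> = copied f \<Zsemi> ((r \<Zsemi> c) \<otimes>\<^sub>a \<one> Y)"
    by (simp add: copied_def sym_natural_arr cmp_assoc_arr tensA_cmp_arr)
  finally show ?thesis
    by simp
qed

section \<open>The universal representative and its comparison maps\<close>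

theorem productive_if_conditionals_ranges:
  assumes cond: "has_conditionals C" and ranges: "has_ranges C"
  shows "productive C"
  unfolding productive_def
proof (intro ballI, goal_cases)
  case (1 X Y \<alpha>)
  then have X: "X \<in> Obj C" and Y: "Y \<in> Obj C" and \<alpha>: "\<alpha> \<in> coend C X Y"
    by simp_all
  obtain W h where rep: "(W, h) \<in> coend_rep C X Y" and \<alpha>_eq: "\<alpha> = coend_rel C X Y `` {(W, h)}"
    using \<alpha> unfolding coend_def by (auto elim!: quotientE)
  \<comment> \<open>The choice of \<open>(W, h)\<close> is immaterial, as all members of
    \<open>\<alpha>\<close> have the same marginal.\<close>
  define f where "f = marginal W Y h"
  have f: "f \<in> hom C X Y"
    using rep Y by (auto simp: f_def coend_rep_def intro: marginal_hom)
  then obtain r where r: "is_range C f r"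
    using ranges by (auto simp: has_ranges_def in_hom_iff)
  have r_hom: "r \<in> hom C (X \<otimes> Y) (X \<otimes> Y)"
    using r f by (auto simp: is_range_def Let_def in_hom_iff)
  \<comment> \<open>With a common marginal, all members factor through the same arrow
    \<open>copied f\<close>.\<close>
  have member: "M \<in> Obj C \<and> (\<exists>c. c \<in> hom C (X \<otimes> Y) M \<and> a = copied f \<Zsemi> (c \<otimes>\<^sub>a \<one> Y))"
    if "(M, a) \<in> \<alpha>" for M a
  proof -
    have rel: "((W, h), (M, a)) \<in> coend_rel C X Y"
      using that \<alpha>_eq by simp
    then have M: "M \<in> Obj C" "a \<in> hom C X (M \<otimes> Y)"
      by (auto simp: coend_rel_def coend_rep_def)
    have "marginal M Y a = f"
      using coend_rel_marginal[OF Y rel] by (simp add: f_def)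
    then show ?thesis
      using copied_factorisation[OF cond M(1) Y M(2)] M(1) by metis
  qed
  define c where "c M a = (SOME c. c \<in> hom C (X \<otimes> Y) M \<and> a = copied f \<Zsemi> (c \<otimes>\<^sub>a \<one> Y))" for M a
  have c: "M \<in> Obj C" "c M a \<in> hom C (X \<otimes> Y) M" "a = copied f \<Zsemi> (c M a \<otimes>\<^sub>a \<one> Y)"
    if "(M, a) \<in> \<alpha>" for M a
    using member[OF that] someI_ex[of "\<lambda>c. c \<in> hom C (X \<otimes> Y) M \<and> a = copied f \<Zsemi> (c \<otimes>\<^sub>a \<one> Y)"]
    unfolding c_def by auto
  \<comment> \<open>Conditionals are not unique; precomposition with \<open>r\<close> makes
    equations between them follow from equations after \<open>copied f\<close>.\<close>
  define s where "s M a = r \<Zsemi> c M a" for M a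
  have s: "s M a \<in> hom C (X \<otimes> Y) M" if "(M, a) \<in> \<alpha>" for M a
    unfolding s_def using r_hom c(2)[OF that] by (rule cmp_hom)
  have a_eq: "a = copied f \<Zsemi> (s M a \<otimes>\<^sub>a \<one> Y)" if "(M, a) \<in> \<alpha>" for M a
    unfolding s_def copied_range[OF f r c(2)[OF that]] using c(3)[OF that] .
  have a_hom: "a \<in> hom C X (M \<otimes> Y)" if "(M, a) \<in> \<alpha>" for M a
    using that \<alpha>_eq by (auto simp: coend_rel_def coend_rep_def)
  have separation: "coend_class C ((X \<otimes> Y) \<otimes> A) B U ((s Mi ai \<otimes>\<^sub>a \<one> A) \<Zsemi> u)
      = coend_class C ((X \<otimes> Y) \<otimes> A) B V ((s Mj aj \<otimes>\<^sub>a \<one> A) \<Zsemi> v)"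
    if i: "(Mi, ai) \<in> \<alpha>" and j: "(Mj, aj) \<in> \<alpha>"
      and A: "A \<in> Obj C" and B: "B \<in> Obj C" and U: "U \<in> Obj C" and V: "V \<in> Obj C"
      and u: "u \<in> hom C (Mi \<otimes> A) (U \<otimes> B)" and v: "v \<in> hom C (Mj \<otimes> A) (V \<otimes> B)"
      and eq: "coend_class C (X \<otimes> A) (B \<otimes> Y) U (plug C Mi Y A U B ai u)
        = coend_class C (X \<otimes> A) (B \<otimes> Y) V (plug C Mj Y A V B aj v)"
    for Mi ai Mj aj A B U V u v
  proof -
    \<comment> \<open>Classes over \<open>B \<otimes> Y\<close> are turned into marginals, the range
      is cancelled, and marginals over \<open>B\<close> are turned back into classes.\<close>
    have "marginal U (B \<otimes> Y) (plug C Mi Y A U B ai u) = marginal V (B \<otimes> Y) (plug C Mj Y A V B aj v)"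
      using eq coend_class_eq_iff[OF cond tens_Obj[OF B Y] U V
        plug_hom[OF c(1)[OF i] Y A U B a_hom[OF i] u] plug_hom[OF c(1)[OF j] Y A V B a_hom[OF j] v]]
      by simp
    then have "marginal U B ((s Mi ai \<otimes>\<^sub>a \<one> A) \<Zsemi> u) = marginal V B ((s Mj aj \<otimes>\<^sub>a \<one> A) \<Zsemi> v)"
      unfolding s_def
      using range_marginal_eq[OF f r A B U V c(2)[OF i] u c(2)[OF j] v]
      by (simp add: c(3)[OF i, symmetric] c(3)[OF j, symmetric])
    moreover have "(s Mi ai \<otimes>\<^sub>a \<one> A) \<Zsemi> u \<in> hom C ((X \<otimes> Y) \<otimes> A) (U \<otimes> B)"
      "(s Mj aj \<otimes>\<^sub>a \<one> A) \<Zsemi> v \<in> hom C ((X \<otimes> Y) \<otimes> A) (V \<otimes> B)"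
      using cmp_hom[OF tensA_hom[OF s[OF i] ide_hom[OF A]] u]
        cmp_hom[OF tensA_hom[OF s[OF j] ide_hom[OF A]] v] .
    ultimately show ?thesis
      using coend_class_eq_iff[OF cond B U V] by blast
  qed
  \<comment> \<open>The witnesses for \<open>M0\<close>, \<open>a0\<close> and \<open>s\<close> are
    \<open>X \<otimes> Y\<close>, \<open>copied f\<close> and the \<open>s\<close> defined
    above.\<close>
  have "copied f \<in> hom C X ((X \<otimes> Y) \<otimes> Y)"
    using f by (simp add: in_hom_iff)
  moreover have "X \<otimes> Y \<in> Obj C"
    using X Y by simp
  ultimately show ?case
    by (intro bexI[of _ "X \<otimes> Y"] bexI[of _ "copied f"] exI[of _ s] conjI ballI impI case_prodI2)
      (assumption | (hypsubst, (rule s a_eq; assumption | rule separation; assumption)))+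
qed

end

theorem theorem9p11:
  fixes C :: "('o, 'a) markov_category"
  assumes "markov_category C"
    and "has_conditionals C"
    and "has_ranges C"
  shows "productive C"
  using assms by (rule markov_category.productive_if_conditionals_ranges)

end
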